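(* Let $N_t$ be the Galton–Watson process in the i.i.d. random environment $\omega=(p_t,\alpha_t)_{t\ge1}$ with generalized geometric offspring laws, and let $P^\omega,E^\omega$ be the quenched probability and expectation. Assume that $$\rho(t,\omega)=\frac{1}{S_t(\omega)}\prod_{i=1}^t\frac{p_i}{\beta_i}\xrightarrow[t\to\infty]{}0\qquad P_m\text{-a.s.},\qquad\text{where } S_t(\omega)=1+\sum_{i=1}^{t}\frac{1-\beta_i}{\beta_i}\prod_{j=1}^{i-1}\frac{p_j}{\beta_j}.$$ Then for every $a\ge 0$, $$P^\omega\left(\frac{N_t}{E^\omega[N_t\mid N_t\ge 1]}>a\ \Big|\ N_t\ge 1\right)\xrightarrow[t\to\infty]{}e^{-a}\qquad P_m\text{-a.s.}$$
   Context: Environment: $(p_t,\alpha_t)$, $t\ge1$, are i.i.d. random vectors with values in $(0,1)^2$ ($p_t$ and $\alpha_t$ with the same $t$ may be dependent); $\beta_t=1-\alpha_t$; $\omega=(p_t,\alpha_t)_{t\ge1}$; $P_m$ is the law of the environment. Given $\omega$, $N_0=1$ and $N_t=\sum_{i=1}^{N_{t-1}}\xi_{t,i}$, where under the quenched (conditional given $\omega$) law $P^\omega$ all $\xi_{t,i}$ are independent with $P^\omega(\xi_{t,i}=0)=\alpha_t$, $P^\omega(\xi_{t,i}=k)=(1-\alpha_t)p_t(1-p_t)^{k-1}$ for $k\ge1$. $E^\omega$ is expectation under $P^\omega$. Empty products equal $1$. *)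

theory Defs
  imports "HOL-Probability.Probability"
begin

locale iid_environment = prob_space M for M :: "'w measure" +
  fixes p \<alpha> :: "nat \<Rightarrow> 'w \<Rightarrow> real"
  assumes env_indep: "indep_vars (\<lambda>_. borel) (\<lambda>t w. (p t w, \<alpha> t w)) {1..}"
    and env_ident: "\<And>t. t \<ge> 1 \<Longrightarrow>
      distr M borel (\<lambda>w. (p t w, \<alpha> t w)) = distr M borel (\<lambda>w. (p 1 w, \<alpha> 1 w))"
    and env_range: "\<And>t w. t \<ge> 1 \<Longrightarrow> w \<in> space M \<Longrightarrow>
      p t w \<in> {0<..<1} \<and> \<alpha> t w \<in> {0<..<1}"

text \<open>The quenched law for one fixed realisation of the environment, given by the deterministic
  sequences \<open>p\<close> and \<open>\<alpha>\<close>; indices start at 1 for both the generation and the individual.\<close>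

locale quenched_offspring = prob_space Q for Q :: "'b measure" +
  fixes p \<alpha> :: "nat \<Rightarrow> real" and \<xi> :: "nat \<Rightarrow> nat \<Rightarrow> 'b \<Rightarrow> nat"
  assumes offspring_indep:
      "indep_vars (\<lambda>_. count_space UNIV) (\<lambda>(t, i). \<xi> t i) ({1..} \<times> {1..})"
    and offspring_zero: "\<And>t i. t \<ge> 1 \<Longrightarrow> i \<ge> 1 \<Longrightarrow>
      \<P>(x in Q. \<xi> t i x = 0) = \<alpha> t"
    and offspring_pos: "\<And>t i k. t \<ge> 1 \<Longrightarrow> i \<ge> 1 \<Longrightarrow> k \<ge> 1 \<Longrightarrow>
      \<P>(x in Q. \<xi> t i x = k) = (1 - \<alpha> t) * p t * (1 - p t) ^ (k - 1)"

primrec gw_process :: "(nat \<Rightarrow> nat \<Rightarrow> 'b \<Rightarrow> nat) \<Rightarrow> nat \<Rightarrow> 'b \<Rightarrow> nat" where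
  "gw_process \<xi> 0 x = 1"
| "gw_process \<xi> (Suc t) x = (\<Sum>i = 1..gw_process \<xi> t x. \<xi> (Suc t) i x)"

definition cond_expectation_event :: "'b measure \<Rightarrow> ('b \<Rightarrow> real) \<Rightarrow> ('b \<Rightarrow> bool) \<Rightarrow> real" where
  "cond_expectation_event Q X A = (\<integral>x. X x \<partial>uniform_measure Q {x \<in> space Q. A x})"

definition env_\<beta> :: "(nat \<Rightarrow> real) \<Rightarrow> nat \<Rightarrow> real" where
  "env_\<beta> \<alpha> t = 1 - \<alpha> t"

definition env_S :: "(nat \<Rightarrow> real) \<Rightarrow> (nat \<Rightarrow> real) \<Rightarrow> nat \<Rightarrow> real" where
  "env_S p \<alpha> t = 1 + (\<Sum>i = 1..t. (1 - env_\<beta> \<alpha> i) / env_\<beta> \<alpha> i * (\<Prod>j = 1..<i. p j / env_\<beta> \<alpha> j))"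

definition env_\<rho> :: "(nat \<Rightarrow> real) \<Rightarrow> (nat \<Rightarrow> real) \<Rightarrow> nat \<Rightarrow> real" where
  "env_\<rho> p \<alpha> t = 1 / env_S p \<alpha> t * (\<Prod>i = 1..t. p i / env_\<beta> \<alpha> i)"

end

(* The offspring generating functions are fractional linear, hence so is the quenched generating
   function of N_t. Reading off its coefficients, N_t conditioned on survival is exactly geometric
   with parameter rho(t), whose mean is 1 / rho(t). The conditional probability in question is
   therefore (1 - rho(t)) ^ floor (a / rho(t)), and this tends to exp (- a) along every environment
   with rho(t) -> 0. *)

theory Submission imports Defs begin

section \<open>Two analytic tools: uniqueness of power series coefficients and an exponential
  limit\<close>

text \<open>Once the coefficients of the difference below index n vanish, dividing by
  \<open>s ^ n\<close> leaves a series with constant term \<open>d n\<close> that sums to 0 for all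
  small s \<noteq> 0; its limit at 0 forces \<open>d n = 0\<close>.\<close>

lemma powser_coeff_unique:
  fixes a b :: "nat \<Rightarrow> real"
  assumes "r > 0"
    and a: "\<And>s. \<bar>s\<bar> < r \<Longrightarrow> (\<lambda>n. a n * s ^ n) sums F s"
    and b: "\<And>s. \<bar>s\<bar> < r \<Longrightarrow> (\<lambda>n. b n * s ^ n) sums F s"
  shows "a n = b n"
proof -
  define d where "d = (\<lambda>n. a n - b n)"
  have d: "(\<lambda>n. d n * s ^ n) sums 0" if "\<bar>s\<bar> < r" for s
    using sums_diff[OF a[OF that] b[OF that]] by (simp add: d_def left_diff_distrib)
  have "d n = 0"
  proof (induction n rule: less_induct)
    case (less n)
    have "(\<lambda>k. d (k + n) * s ^ k) sums 0" if s: "s \<noteq> 0" "\<bar>s\<bar> < r" for s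
    proof -
      have "(\<lambda>k. d (k + n) * s ^ (k + n)) sums 0"
        using less d[OF s(2)] by (subst sums_iff_shift) simp
      from sums_divide[OF this, of "s ^ n"] show ?thesis
        using s by (simp add: power_add)
    qed
    then have "((\<lambda>_. 0) \<longlongrightarrow> d (0 + n)) (at (0::real))"
      by (intro powser_limit_0_strong[OF \<open>r > 0\<close>, of "\<lambda>k. d (k + n)"]) auto
    then show ?case
      by (simp add: tendsto_const_iff)
  qed
  then show ?thesis by (simp add: d_def)
qed

text \<open>With k = floor(a/r), the power equals exp of (k r) times (ln(1 - r) / r). The first
  factor tends to a, the second to -1, the derivative of ln(1 - r) at 0.\<close>

lemma tendsto_one_minus_power_floor:
  fixes a :: real
  assumes "a \<ge> 0"
  shows "((\<lambda>r. (1 - r) ^ nat \<lfloor>a / r\<rfloor>) \<longlongrightarrow> exp (- a)) (at_right 0)"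
proof -
  have ev: "eventually (\<lambda>r::real. r \<in> {0<..<1}) (at_right 0)"
    by (rule eventually_at_right_real) simp
  have 1: "((\<lambda>r. ln (1 - r) / r) \<longlongrightarrow> -1) (at_right (0::real))"
  proof -
    have "((\<lambda>r::real. ln (1 - r)) has_real_derivative -1) (at 0)"
      by (auto intro!: derivative_eq_intros)
    then have "((\<lambda>r. ln (1 - r) / r) \<longlongrightarrow> -1) (at (0::real))"
      by (simp add: has_field_derivative_iff)
    then show ?thesis by (rule filterlim_mono) (auto intro: at_le)
  qed
  \<comment> \<open>Squeeze: multiply a/r - 1 \<le> floor(a/r) \<le> a/r by r > 0.\<close>
  have 2: "((\<lambda>r. real (nat \<lfloor>a / r\<rfloor>) * r) \<longlongrightarrow> a) (at_right (0::real))"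
  proof (rule tendsto_sandwich)
    show "((\<lambda>r. a - r) \<longlongrightarrow> a) (at_right 0)" by (auto intro!: tendsto_eq_intros)
    show "((\<lambda>r. a) \<longlongrightarrow> a) (at_right 0)" by simp
    show "eventually (\<lambda>r. a - r \<le> real (nat \<lfloor>a / r\<rfloor>) * r) (at_right 0)"
      using ev
    proof eventually_elim
      case (elim r)
      have "a / r - 1 \<le> real (nat \<lfloor>a / r\<rfloor>)" by linarith
      from mult_right_mono[OF this, of r] elim show ?case by (simp add: field_simps)
    qed
    show "eventually (\<lambda>r. real (nat \<lfloor>a / r\<rfloor>) * r \<le> a) (at_right 0)"
      using ev
    proof eventually_elim
      case (elim r)
      have "0 \<le> a / r" using elim assms by simp
      then have "real (nat \<lfloor>a / r\<rfloor>) \<le> a / r" by linarith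
      from mult_right_mono[OF this, of r] elim show ?case by simp
    qed
  qed
  have "((\<lambda>r. exp ((real (nat \<lfloor>a / r\<rfloor>) * r) * (ln (1 - r) / r))) \<longlongrightarrow> exp (a * -1)) (at_right 0)"
    by (intro tendsto_exp tendsto_mult 1 2)
  moreover have "eventually (\<lambda>r. exp ((real (nat \<lfloor>a / r\<rfloor>) * r) * (ln (1 - r) / r))
      = (1 - r) ^ nat \<lfloor>a / r\<rfloor>) (at_right 0)"
    using ev by eventually_elim (simp add: exp_of_nat_mult)
  ultimately show ?thesis
    by (simp add: filterlim_cong)
qed

section \<open>Expectations and generating functions of variables with values in the
  naturals\<close>

lemma (in prob_space) expectation_indicator_singleton:
  assumes [measurable]: "N \<in> measurable M (count_space UNIV)"
  shows "expectation (\<lambda>x. indicator {n} (N x)) = prob {x \<in> space M. N x = n}"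
proof -
  have "expectation (\<lambda>x. indicator {n} (N x) :: real) = expectation (indicator {x \<in> space M. N x = n})"
    by (intro Bochner_Integration.integral_cong) (auto simp: indicator_def)
  then show ?thesis by simp
qed

text \<open>Split over the value of N and exchange sum and integral. At each point only the term n =
  N x survives; the bound \<open>c\<close> supplies the summability of the integrals of absolute
  values.\<close>

lemma (in prob_space) sums_expectation_random_index:
  fixes h :: "nat \<Rightarrow> 'a \<Rightarrow> real"
  assumes N[measurable]: "N \<in> measurable M (count_space UNIV)"
    and h[measurable]: "\<And>n. h n \<in> borel_measurable M"
    and bound: "\<And>n x. x \<in> space M \<Longrightarrow> \<bar>h n x\<bar> \<le> c n"
    and summable: "summable (\<lambda>n. prob {x \<in> space M. N x = n} * c n)"
  shows "(\<lambda>n. expectation (\<lambda>x. indicator {n} (N x) * h n x)) sums expectation (\<lambda>x. h (N x) x)"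
proof -
  let ?f = "\<lambda>n x. indicator {n} (N x) * h n x"
  have f: "\<bar>?f n x\<bar> \<le> indicator {n} (N x) * c n" if "x \<in> space M" for n x
    using bound[OF that, of n] by (simp add: indicator_def)
  have int_c: "integrable M (\<lambda>x. indicator {n} (N x) * c n)" for n
    by (rule integrable_const_bound[where B="\<bar>c n\<bar>"]) (auto simp: indicator_def)
  have int: "integrable M (?f n)" for n
  proof (rule Bochner_Integration.integrable_bound[OF int_c[of n]])
    show "?f n \<in> borel_measurable M"
      by (intro borel_measurable_times measurable_compose[OF N] h) simp
  qed (use f in \<open>auto intro!: AE_I2 order_trans[OF _ abs_ge_self]\<close>)
  have "(\<lambda>n. expectation (?f n)) sums expectation (\<lambda>x. \<Sum>n. ?f n x)"
  proof (rule sums_integral[OF int])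
    show "AE x in M. summable (\<lambda>n. norm (?f n x))"
    proof (intro AE_I2)
      fix x show "summable (\<lambda>n. norm (?f n x))"
        by (rule summable_finite[of "{N x}"]) auto
    qed
    show "summable (\<lambda>n. expectation (\<lambda>x. norm (?f n x)))"
    proof (rule summable_comparison_test'[OF summable])
      fix n
      have "norm (expectation (\<lambda>x. norm (?f n x))) = expectation (\<lambda>x. norm (?f n x))"
        by simp
      also have "\<dots> \<le> expectation (\<lambda>x. indicator {n} (N x) * c n)"
        by (rule integral_mono) (use int int_c f in auto)
      finally show "norm (expectation (\<lambda>x. norm (?f n x))) \<le> prob {x \<in> space M. N x = n} * c n"
        by (simp add: expectation_indicator_singleton[OF N])
    qed
  qed
  moreover have "(\<Sum>n. ?f n x) = h (N x) x" for x
    by (subst suminf_finite[of "{N x}"]) auto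
  ultimately show ?thesis by simp
qed

lemma (in prob_space) sums_expectation_nat:
  fixes g :: "nat \<Rightarrow> real"
  assumes N[measurable]: "N \<in> measurable M (count_space UNIV)"
    and summable: "summable (\<lambda>n. prob {x \<in> space M. N x = n} * \<bar>g n\<bar>)"
  shows "(\<lambda>n. prob {x \<in> space M. N x = n} * g n) sums expectation (\<lambda>x. g (N x))"
proof -
  have "expectation (\<lambda>x. indicator {n} (N x) * g n) = prob {x \<in> space M. N x = n} * g n" for n
    using expectation_indicator_singleton[OF N] by (cases "g n = 0") auto
  moreover have "(\<lambda>n. expectation (\<lambda>x. indicator {n} (N x) * g n)) sums expectation (\<lambda>x. g (N x))"
    by (rule sums_expectation_random_index[OF N _ _ summable]) auto
  ultimately show ?thesis by presburger
qed

lemma (in prob_space) summable_prob_nat: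
  assumes N[measurable]: "N \<in> measurable M (count_space (UNIV :: nat set))"
  shows "summable (\<lambda>n. prob {x \<in> space M. N x = n})"
proof -
  have "(\<lambda>n. prob {x \<in> space M. N x = n}) sums prob (\<Union>n. {x \<in> space M. N x = n})"
    by (rule finite_measure_UNION) (auto simp: disjoint_family_on_def)
  then show ?thesis by (rule sums_summable)
qed

lemma (in prob_space) pgf_sums:
  assumes N[measurable]: "N \<in> measurable M (count_space UNIV)" and "\<bar>s\<bar> \<le> 1"
  shows "(\<lambda>n. prob {x \<in> space M. N x = n} * s ^ n) sums expectation (\<lambda>x. (s::real) ^ N x)"
proof (rule sums_expectation_nat[OF N])
  show "summable (\<lambda>n. prob {x \<in> space M. N x = n} * \<bar>s ^ n\<bar>)"
    by (rule summable_comparison_test'[OF summable_prob_nat[OF N]])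
       (use assms(2) in \<open>auto simp: abs_mult power_abs intro!: mult_left_le power_le_one\<close>)
qed

text \<open>On N = n the independence of N and \<open>Z n\<close> factors the term into P(N = n)
  times \<open>f ^ n\<close>; summing over n gives the generating function of N at f. With
  \<open>Z n\<close> the total offspring of n individuals, this composes generating
  functions.\<close>

lemma (in prob_space) pgf_random_sum:
  fixes N :: "'a \<Rightarrow> nat" and Z :: "nat \<Rightarrow> 'a \<Rightarrow> nat"
  assumes indep: "\<And>n. indep_var (count_space UNIV) N (count_space UNIV) (Z n)"
    and Z: "\<And>n. expectation (\<lambda>x. s ^ Z n x) = f ^ n"
    and s: "\<bar>s\<bar> \<le> 1" and f: "\<bar>f\<bar> \<le> (1::real)"
  shows "expectation (\<lambda>x. s ^ Z (N x) x) = expectation (\<lambda>x. f ^ N x)"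
proof -
  have N[measurable]: "N \<in> measurable M (count_space UNIV)"
    and Zm[measurable]: "\<And>n. Z n \<in> measurable M (count_space UNIV)"
    using indep indep_var_rv1 indep_var_rv2 by blast+
  have "(\<lambda>n. expectation (\<lambda>x. indicator {n} (N x) * s ^ Z n x)) sums expectation (\<lambda>x. s ^ Z (N x) x)"
    by (rule sums_expectation_random_index[where c="\<lambda>_. 1"])
       (use s in \<open>auto simp: power_abs summable_prob_nat power_le_one\<close>)
  moreover have "expectation (\<lambda>x. indicator {n} (N x) * s ^ Z n x) =
      prob {x \<in> space M. N x = n} * f ^ n" for n
  proof -
    have "indep_var borel (indicator {n} \<circ> N) borel ((\<lambda>k. s ^ k) \<circ> Z n)"
      by (rule indep_var_compose[OF indep]) auto
    then have "expectation (\<lambda>x. indicator {n} (N x) * s ^ Z n x) =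
        expectation (\<lambda>x. indicator {n} (N x)) * expectation (\<lambda>x. s ^ Z n x)"
      unfolding comp_def
      by (rule indep_var_lebesgue_integral)
         (auto intro!: integrable_const_bound[where B=1] AE_I2
            simp: indicator_def power_abs s power_le_one)
    then show ?thesis by (simp add: Z expectation_indicator_singleton[OF N])
  qed
  ultimately show ?thesis
    using sums_unique2 pgf_sums[OF N f] by simp
qed

section \<open>The tail of a geometric variable measured in units of its mean\<close>

text \<open>The mean is 1/r, so the event is N > a/r, that is N > m with m = floor(a/r), and the
  geometric tail beyond m sums to \<open>(1 - r) ^ m\<close>.\<close>

lemma (in prob_space) geometric_tail_above_mean:
  assumes N[measurable]: "N \<in> measurable M (count_space UNIV)"
    and r: "0 < r" "r < (1::real)" and "a \<ge> 0"
    and geom: "\<And>k. k \<ge> 1 \<Longrightarrow> prob {x \<in> space M. N x = k} = r * (1 - r) ^ (k - 1)"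
  shows "prob {x \<in> space M. real (N x) / expectation (\<lambda>y. real (N y)) > a} = (1 - r) ^ nat \<lfloor>a / r\<rfloor>"
proof -
  have "(\<lambda>n. prob {x \<in> space M. N x = n} * real n) sums (1 / r)"
  proof -
    \<comment> \<open>The differentiated geometric series has sum 1/r^2. The later shift from
      \<open>Suc n\<close> to n is free because the term at 0 carries the factor
      \<open>real 0\<close>.\<close>
    have "(\<lambda>n. r * (of_nat (Suc n) * (1 - r) ^ n)) sums (r * (1 / (1 - (1 - r))\<^sup>2))"
      by (intro sums_mult geometric_deriv_sums) (use r in auto)
    then have "(\<lambda>n. prob {x \<in> space M. N x = Suc n} * real (Suc n)) sums (1 / r)"
      using r by (simp add: geom power2_eq_square mult_ac)
    then show ?thesis by (subst (asm) sums_Suc_iff) simp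
  qed
  moreover from this have "(\<lambda>n. prob {x \<in> space M. N x = n} * real n) sums expectation (\<lambda>x. real (N x))"
    by (intro sums_expectation_nat[OF N]) (simp add: sums_iff)
  ultimately have E: "expectation (\<lambda>x. real (N x)) = 1 / r"
    using sums_unique2 by blast
  let ?m = "nat \<lfloor>a / r\<rfloor>"
  \<comment> \<open>N > m means N = m + 1 + k for some k \<ge> 0; hence the offset
    \<open>Suc\<close>.\<close>
  have "(\<lambda>k. prob {x \<in> space M. N x = Suc (k + ?m)}) sums prob (\<Union>k. {x \<in> space M. N x = Suc (k + ?m)})"
    by (rule finite_measure_UNION) (auto simp: disjoint_family_on_def)
  moreover have "(\<lambda>k. prob {x \<in> space M. N x = Suc (k + ?m)}) sums ((1 - r) ^ ?m)"
  proof -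
    have "(\<lambda>k. r * (1 - r) ^ ?m * (1 - r) ^ k) sums (r * (1 - r) ^ ?m * (1 / (1 - (1 - r))))"
      by (intro sums_mult geometric_sums) (use r in auto)
    then show ?thesis using r by (simp add: geom power_add mult_ac)
  qed
  ultimately have "prob (\<Union>k. {x \<in> space M. N x = Suc (k + ?m)}) = (1 - r) ^ ?m"
    using sums_unique2 by blast
  moreover have "(\<Union>k. {x \<in> space M. N x = Suc (k + ?m)}) =
      {x \<in> space M. real (N x) / expectation (\<lambda>y. real (N y)) > a}"
  proof -
    have "real n / (1 / r) > a \<longleftrightarrow> (\<exists>k. n = Suc (k + ?m))" for n
    proof -
      have "real n / (1 / r) > a \<longleftrightarrow> a / r < real n"
        using r by (simp add: field_simps)
      also have "\<dots> \<longleftrightarrow> ?m < n"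
        using r \<open>a \<ge> 0\<close> by (simp add: floor_less_iff nat_less_iff)
      also have "\<dots> \<longleftrightarrow> (\<exists>k. n = Suc (k + ?m))"
        by (metis less_iff_Suc_add add.commute)
      finally show ?thesis .
    qed
    then show ?thesis by (auto simp: E)
  qed
  ultimately show ?thesis by simp
qed

section \<open>Measurability of the process and independence of successive generations\<close>

lemma measurable_sum_nat:
  fixes f :: "'i \<Rightarrow> 'a \<Rightarrow> nat"
  assumes "\<And>i. i \<in> A \<Longrightarrow> f i \<in> measurable M (count_space UNIV)"
  shows "(\<lambda>x. \<Sum>i\<in>A. f i x) \<in> measurable M (count_space UNIV)"
  using assms
proof (induction A rule: infinite_finite_induct)
  case (insert i A)
  then have [measurable]: "f i \<in> measurable M (count_space UNIV)"
      "(\<lambda>x. \<Sum>i\<in>A. f i x) \<in> measurable M (count_space UNIV)" by auto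
  show ?case using insert.hyps by simp
qed auto

text \<open>Only generations 1 to t enter. The sample points may lie in different spaces, so the
  process can be transferred to the coordinate process on a product space.\<close>

lemma gw_process_cong:
  assumes "\<And>s i. 1 \<le> s \<Longrightarrow> s \<le> t \<Longrightarrow> 1 \<le> i \<Longrightarrow> \<xi> s i x = \<eta> s i y"
  shows "gw_process \<xi> t x = gw_process \<eta> t y"
  using assms by (induction t) (auto intro!: sum.cong)

lemma measurable_gw_process:
  assumes "\<And>s i. 1 \<le> s \<Longrightarrow> s \<le> t \<Longrightarrow> 1 \<le> i \<Longrightarrow> \<xi> s i \<in> measurable M (count_space UNIV)"
  shows "gw_process \<xi> t \<in> measurable M (count_space UNIV)"
  using assms
proof (induction t)
  case (Suc t)
  \<comment> \<open>A sum with a random number of terms is a countable family of measurable sums,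
    evaluated at a measurable index.\<close>
  have "(\<lambda>x. (\<lambda>n x. \<Sum>i = 1..n. \<xi> (Suc t) i x) (gw_process \<xi> t x) x) \<in> measurable M (count_space UNIV)"
  proof (rule measurable_compose_countable[where f="\<lambda>n x. \<Sum>i = 1..n. \<xi> (Suc t) i x" and g="gw_process \<xi> t"])
    show "(\<lambda>x. \<Sum>i = 1..n. \<xi> (Suc t) i x) \<in> measurable M (count_space UNIV)" for n
      using Suc.prems by (intro measurable_sum_nat) auto
    show "gw_process \<xi> t \<in> measurable M (count_space UNIV)"
      using Suc by simp
  qed
  then show ?case by simp
next
  case 0
  have "gw_process \<xi> 0 = (\<lambda>_. 1)" by auto
  then show ?case by simp
qed

context quenched_offspring
begin

lemma measurable_offspring:
  assumes "t \<ge> 1" "i \<ge> 1"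
  shows "\<xi> t i \<in> measurable Q (count_space UNIV)"
  using offspring_indep assms by (auto simp: indep_vars_def)

lemma measurable_gw [measurable]: "gw_process \<xi> t \<in> measurable Q (count_space UNIV)"
  by (intro measurable_gw_process measurable_offspring)

text \<open>The two variables are functions of disjoint blocks of the independent offspring family:
  generations 1 to t, and generation t + 1. For each fixed n this is the independence that
  \<open>pgf_random_sum\<close> asks for.\<close>

lemma indep_gw_next_generation:
  "indep_var (count_space UNIV) (gw_process \<xi> t) (count_space UNIV) (\<lambda>x. \<Sum>i = 1..n. \<xi> (Suc t) i x)"
proof -
  let ?A = "{1..t} \<times> {1::nat..}" and ?B = "{Suc t} \<times> {1::nat..}"
  let ?X = "\<lambda>(t, i). \<xi> t i"
  let ?P = "\<lambda>A. PiM A (\<lambda>_::nat \<times> nat. count_space (UNIV :: nat set))"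
  \<comment> \<open>\<open>?g\<close> and \<open>?z\<close> express both variables through the
    coordinates of their own block.\<close>
  let ?g = "gw_process (\<lambda>s i y. y (s, i)) t :: (nat \<times> nat \<Rightarrow> nat) \<Rightarrow> nat"
  let ?z = "\<lambda>y :: nat \<times> nat \<Rightarrow> nat. \<Sum>i = 1..n. y (Suc t, i)"
  have "indep_var (?P ?A) (\<lambda>x. restrict (\<lambda>k. ?X k x) ?A) (?P ?B) (\<lambda>x. restrict (\<lambda>k. ?X k x) ?B)"
    by (rule indep_var_restrict[OF offspring_indep]) auto
  moreover have "?g \<in> measurable (?P ?A) (count_space UNIV)"
    by (intro measurable_gw_process measurable_component_singleton) auto
  moreover have "?z \<in> measurable (?P ?B) (count_space UNIV)"
    by (intro measurable_sum_nat measurable_component_singleton) auto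
  ultimately have "indep_var (count_space UNIV) (?g \<circ> (\<lambda>x. restrict (\<lambda>k. ?X k x) ?A))
      (count_space UNIV) (?z \<circ> (\<lambda>x. restrict (\<lambda>k. ?X k x) ?B))"
    by (rule indep_var_compose)
  moreover have "?g \<circ> (\<lambda>x. restrict (\<lambda>k. ?X k x) ?A) = gw_process \<xi> t"
    unfolding comp_def by (intro ext gw_process_cong) auto
  moreover have "?z \<circ> (\<lambda>x. restrict (\<lambda>k. ?X k x) ?B) = (\<lambda>x. \<Sum>i = 1..n. \<xi> (Suc t) i x)"
    by (auto simp: fun_eq_iff intro!: sum.cong)
  ultimately show ?thesis by simp
qed

section \<open>Generating functions of the offspring\<close>

lemma pgf_sum_offspring:
  assumes t: "t \<ge> 1" and s: "\<bar>s\<bar> \<le> (1::real)"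
    and f: "\<And>i. i \<ge> 1 \<Longrightarrow> expectation (\<lambda>x. s ^ \<xi> t i x) = f"
  shows "expectation (\<lambda>x. s ^ (\<Sum>i = 1..n. \<xi> t i x)) = f ^ n"
proof -
  \<comment> \<open>The singleton factor keeps the pair indexing of
    \<open>offspring_indep\<close>.\<close>
  have "indep_vars (\<lambda>_. count_space UNIV) (\<lambda>(t, i). \<xi> t i) ({t} \<times> {1..n})"
    by (rule indep_vars_subset[OF offspring_indep]) (use t in auto)
  then have indep: "indep_vars (\<lambda>_. borel) (\<lambda>k x. s ^ (case k of (t, i) \<Rightarrow> \<xi> t i) x) ({t} \<times> {1..n})"
    by (rule indep_vars_compose2) auto
  have int: "integrable Q (\<lambda>x. s ^ (case k of (t, i) \<Rightarrow> \<xi> t i) x)" if "k \<in> {t} \<times> {1..n}" for k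
    using that t s measurable_offspring[of t "snd k"]
    by (intro integrable_const_bound[where B=1] AE_I2) (auto simp: power_abs power_le_one)
  have "expectation (\<lambda>x. \<Prod>k\<in>{t} \<times> {1..n}. s ^ (case k of (t, i) \<Rightarrow> \<xi> t i) x) =
      (\<Prod>k\<in>{t} \<times> {1..n}. expectation (\<lambda>x. s ^ (case k of (t, i) \<Rightarrow> \<xi> t i) x))"
    by (rule indep_vars_lebesgue_integral[OF _ indep int]) auto
  then have "expectation (\<lambda>x. \<Prod>i = 1..n. s ^ \<xi> t i x) = (\<Prod>i = 1..n. expectation (\<lambda>x. s ^ \<xi> t i x))"
    by (simp add: prod.cartesian_product' split_beta)
  also have "\<dots> = f ^ n" using f by simp
  finally show ?thesis by (simp add: power_sum)
qed

text \<open>The atom at 0 plus a geometric series of ratio (1 - p) s. The formula displays 1 - f(s),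
  whose reciprocal is affine in 1 / (1 - s).\<close>

lemma pgf_offspring:
  assumes t: "t \<ge> 1" "i \<ge> 1" and s: "\<bar>s\<bar> < (1::real)" and p: "0 < p t" "p t < 1"
  shows "expectation (\<lambda>x. s ^ \<xi> t i x) = 1 - (1 - \<alpha> t) * (1 - s) / (1 - (1 - p t) * s)"
proof -
  have ps: "\<bar>(1 - p t) * s\<bar> < 1"
  proof -
    have "\<bar>(1 - p t) * s\<bar> \<le> 1 * \<bar>s\<bar>"
      unfolding abs_mult by (rule mult_right_mono) (use p in auto)
    then show ?thesis using s by simp
  qed
  have "(\<lambda>n. (1 - \<alpha> t) * p t * s * ((1 - p t) * s) ^ n) sums
      ((1 - \<alpha> t) * p t * s * (1 / (1 - (1 - p t) * s)))"
    by (intro sums_mult geometric_sums) (use ps in simp)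
  then have "(\<lambda>n. prob {x \<in> space Q. \<xi> t i x = Suc n} * s ^ Suc n) sums
      ((1 - \<alpha> t) * p t * s / (1 - (1 - p t) * s))"
    using t by (simp add: offspring_pos power_mult_distrib mult_ac)
  then have "(\<lambda>n. prob {x \<in> space Q. \<xi> t i x = n} * s ^ n) sums
      ((1 - \<alpha> t) * p t * s / (1 - (1 - p t) * s) + \<alpha> t)"
    using t by (subst (asm) sums_Suc_iff) (simp add: offspring_zero)
  moreover have "(\<lambda>n. prob {x \<in> space Q. \<xi> t i x = n} * s ^ n) sums expectation (\<lambda>x. s ^ \<xi> t i x)"
    by (rule pgf_sums[OF measurable_offspring[OF t]]) (use s in simp)
  ultimately have "expectation (\<lambda>x. s ^ \<xi> t i x) =
      (1 - \<alpha> t) * p t * s / (1 - (1 - p t) * s) + \<alpha> t"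
    using sums_unique2 by blast
  moreover have "1 - (1 - p t) * s \<noteq> 0" using ps by linarith
  ultimately show ?thesis by (simp add: field_simps)
qed

end

section \<open>The environment quantities S and rho, and the generating function of N_t\<close>

lemma env_S_Suc:
  "env_S p \<alpha> (Suc t) = env_S p \<alpha> t +
    \<alpha> (Suc t) / (1 - \<alpha> (Suc t)) * (\<Prod>i = 1..t. p i / env_\<beta> \<alpha> i)"
  by (simp add: env_S_def env_\<beta>_def atLeastLessThanSuc_atLeastAtMost)

context
  fixes p \<alpha> :: "nat \<Rightarrow> real"
  assumes range: "\<And>t. t \<ge> 1 \<Longrightarrow> p t \<in> {0<..<1} \<and> \<alpha> t \<in> {0<..<1}"
begin

lemma env_S_ge_1: "env_S p \<alpha> t \<ge> 1"
  unfolding env_S_def env_\<beta>_def using range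
  by (auto intro!: sum_nonneg mult_nonneg_nonneg divide_nonneg_nonneg prod_nonneg simp: less_imp_le)

lemma prod_env_pos: "(\<Prod>i = 1..t. p i / env_\<beta> \<alpha> i) > 0"
  unfolding env_\<beta>_def using range by (intro prod_pos) auto

text \<open>This is (1 - \<alpha>) p < 1 - \<alpha> multiplied out, the form that arises after
  clearing denominators.\<close>

lemma add_less_one_plus_mult: "t \<ge> 1 \<Longrightarrow> \<alpha> t + p t < 1 + \<alpha> t * p t"
  using range[of t] mult_strict_left_mono[of "p t" 1 "1 - \<alpha> t"] by (simp add: algebra_simps)

text \<open>Let B be the product up to t. One step turns B into B p/\<beta> and adds B
  \<alpha>/\<beta> to S; since p/\<beta> \<le> 1 + \<alpha>/\<beta> = 1/\<beta>, the bound B \<le> S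
  is inherited.\<close>

lemma prod_env_le_env_S: "(\<Prod>i = 1..t. p i / env_\<beta> \<alpha> i) \<le> env_S p \<alpha> t"
proof (induction t)
  case (Suc t)
  have "p (Suc t) / env_\<beta> \<alpha> (Suc t) \<le> 1 + \<alpha> (Suc t) / (1 - \<alpha> (Suc t))"
    using add_less_one_plus_mult[of "Suc t"] range[of "Suc t"] by (simp add: env_\<beta>_def field_simps)
  from mult_left_mono[OF this less_imp_le[OF prod_env_pos[of t]]] Suc show ?case
    by (simp add: env_S_Suc algebra_simps)
qed (simp add: env_S_def)

text \<open>The last step makes the inequality strict; at t = 0 both sides equal 1.\<close>

lemma prod_env_less_env_S:
  assumes "t \<ge> 1"
  shows "(\<Prod>i = 1..t. p i / env_\<beta> \<alpha> i) < env_S p \<alpha> t"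
proof -
  obtain u where t: "t = Suc u" using assms by (cases t) auto
  have "p t / env_\<beta> \<alpha> t < 1 + \<alpha> t / (1 - \<alpha> t)"
    using add_less_one_plus_mult[OF assms] range[OF assms] by (simp add: env_\<beta>_def field_simps)
  from mult_strict_left_mono[OF this prod_env_pos[of u]] prod_env_le_env_S[of u] show ?thesis
    by (simp add: t env_S_Suc algebra_simps)
qed

lemma env_\<rho>_bounds: "0 < env_\<rho> p \<alpha> t" "t \<ge> 1 \<Longrightarrow> env_\<rho> p \<alpha> t < 1"
  using prod_env_pos[of t] prod_env_less_env_S[of t] env_S_ge_1[of t] by (auto simp: env_\<rho>_def)

end

text \<open>The map \<open>s \<mapsto> 1 / (1 - s)\<close> conjugates the offspring generating functions to affine maps,
  hence also their compositions.\<close>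

lemma (in quenched_offspring) pgf_gw:
  assumes range: "\<And>t. t \<ge> 1 \<Longrightarrow> p t \<in> {0<..<1} \<and> \<alpha> t \<in> {0<..<1}"
    and s: "\<bar>s\<bar> < 1"
  shows "expectation (\<lambda>x. s ^ gw_process \<xi> t x) = 1 - 1 /
    (env_S p \<alpha> t - (\<Prod>i = 1..t. p i / env_\<beta> \<alpha> i) + (\<Prod>i = 1..t. p i / env_\<beta> \<alpha> i) / (1 - s))"
  using s
proof (induction t arbitrary: s)
  case 0
  then show ?case by (simp add: env_S_def prob_space)
next
  case (Suc t)
  let ?p = "p (Suc t)" and ?\<alpha> = "\<alpha> (Suc t)" and ?B = "\<Prod>i = 1..t. p i / env_\<beta> \<alpha> i"
  \<comment> \<open>f is the generating function of generation t + 1 at s. The induction hypothesis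
    is applied at f, which requires \<bar>f\<bar> < 1.\<close>
  define f where "f = 1 - (1 - ?\<alpha>) * (1 - s) / (1 - (1 - ?p) * s)"
  have r: "0 < ?p" "?p < 1" "0 < ?\<alpha>" "?\<alpha> < 1" using range[of "Suc t"] by auto
  have ps: "1 - (1 - ?p) * s > 0"
  proof -
    have "(1 - ?p) * s \<le> 1 - ?p" using Suc.prems r by (intro mult_left_le) auto
    then show ?thesis using r by linarith
  qed
  have f: "\<bar>f\<bar> < 1"
  proof -
    \<comment> \<open>For 1 - f < 2: the difference 2 (1 - (1 - p) s) - (1 - s) equals 1 - (1 - 2p)
      s, which is positive.\<close>
    have "\<bar>(1 - 2 * ?p) * s\<bar> \<le> 1 * \<bar>s\<bar>"
      unfolding abs_mult by (rule mult_right_mono) (use r in auto)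
    then have "1 - s < 2 * (1 - (1 - ?p) * s)" using Suc.prems by (simp add: algebra_simps)
    moreover have "(1 - ?\<alpha>) * (1 - s) \<le> 1 * (1 - s)"
      using r Suc.prems by (intro mult_right_mono) auto
    ultimately have "(1 - ?\<alpha>) * (1 - s) / (1 - (1 - ?p) * s) < 2"
      using ps by (simp add: divide_less_eq)
    moreover have "(1 - ?\<alpha>) * (1 - s) / (1 - (1 - ?p) * s) > 0"
      using ps r Suc.prems by simp
    ultimately show ?thesis by (simp add: f_def abs_less_iff)
  qed
  have f_eq: "expectation (\<lambda>x. s ^ \<xi> (Suc t) i x) = f" if "i \<ge> 1" for i
    unfolding f_def by (rule pgf_offspring) (use that Suc.prems r in auto)
  have "expectation (\<lambda>x. s ^ gw_process \<xi> (Suc t) x) = expectation (\<lambda>x. f ^ gw_process \<xi> t x)"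
    unfolding gw_process.simps
    by (rule pgf_random_sum[where Z="\<lambda>n x. \<Sum>i = 1..n. \<xi> (Suc t) i x", OF indep_gw_next_generation])
       (use Suc.prems f in \<open>auto simp del: One_nat_def intro!: pgf_sum_offspring f_eq\<close>)
  also have "\<dots> = 1 - 1 / (env_S p \<alpha> t - ?B + ?B / (1 - f))"
    by (rule Suc.IH[OF f])
  also have "env_S p \<alpha> t - ?B + ?B / (1 - f) =
      env_S p \<alpha> (Suc t) - ?B * (?p / (1 - ?\<alpha>)) + ?B * (?p / (1 - ?\<alpha>)) / (1 - s)"
  proof -
    \<comment> \<open>The affine action of the last generation on 1 / (1 - s). Its constant is (1 -
      p)/\<beta>, split so that B \<alpha>/\<beta> becomes the increment of S and B p/\<beta> the
      new product.\<close>
    have "1 / (1 - f) = 1 + ?\<alpha> / (1 - ?\<alpha>) - ?p / (1 - ?\<alpha>) + ?p / (1 - ?\<alpha>) / (1 - s)"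
    proof -
      have u: "1 - s \<noteq> 0" "1 - ?\<alpha> \<noteq> 0" using Suc.prems r by auto
      have "1 / (1 - f) = (?p + (1 - ?p) * (1 - s)) / ((1 - ?\<alpha>) * (1 - s))"
        by (simp add: f_def algebra_simps)
      also have "\<dots> = ?p / (1 - ?\<alpha>) / (1 - s) + (1 - ?p) / (1 - ?\<alpha>)"
        using u by (simp add: add_divide_distrib)
      also have "(1 - ?p) / (1 - ?\<alpha>) = 1 + ?\<alpha> / (1 - ?\<alpha>) - ?p / (1 - ?\<alpha>)"
        using u by (simp add: divide_simps)
      finally show ?thesis by simp
    qed
    then have "?B * (1 / (1 - f)) = ?B * (1 + ?\<alpha> / (1 - ?\<alpha>) - ?p / (1 - ?\<alpha>) + ?p / (1 - ?\<alpha>) / (1 - s))"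
      by (rule arg_cong)
    then show ?thesis unfolding env_S_Suc by (simp add: algebra_simps)
  qed
  finally show ?case by (simp add: env_\<beta>_def)
qed

section \<open>The law of N_t, its law given survival, and the limit\<close>

text \<open>Since the product equals r S, the generating function expands as a geometric series of
  ratio (1 - r) s, and coefficients are compared. The survival probability is therefore 1/S.\<close>

lemma (in quenched_offspring) prob_gw:
  assumes range: "\<And>t. t \<ge> 1 \<Longrightarrow> p t \<in> {0<..<1} \<and> \<alpha> t \<in> {0<..<1}" and t: "t \<ge> 1"
  defines "r \<equiv> env_\<rho> p \<alpha> t"
  shows "prob {x \<in> space Q. gw_process \<xi> t x = n} =
    (if n = 0 then 1 - 1 / env_S p \<alpha> t else r * (1 - r) ^ (n - 1) / env_S p \<alpha> t)"
proof -
  let ?S = "env_S p \<alpha> t"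
  let ?b = "\<lambda>n. if n = 0 then 1 - 1 / ?S else r * (1 - r) ^ (n - 1) / ?S"
  have S: "?S \<ge> 1" by (rule env_S_ge_1[OF range])
  have r: "0 < r" "r < 1" using env_\<rho>_bounds[of p \<alpha> t, OF range] t by (auto simp: r_def)
  have B: "(\<Prod>i = 1..t. p i / env_\<beta> \<alpha> i) = r * ?S" using S by (simp add: r_def env_\<rho>_def)
  \<comment> \<open>The instantiation \<open>r=1\<close> sets the radius in
    \<open>powser_coeff_unique\<close>; it does not concern rho.\<close>
  show ?thesis
  proof (rule powser_coeff_unique[where r=1 and b="?b" and F="\<lambda>s. expectation (\<lambda>x. s ^ gw_process \<xi> t x)"])
    fix s :: real assume s: "\<bar>s\<bar> < 1"
    show "(\<lambda>n. prob {x \<in> space Q. gw_process \<xi> t x = n} * s ^ n) sums expectation (\<lambda>x. s ^ gw_process \<xi> t x)"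
      by (rule pgf_sums) (use s in auto)
    have rs: "\<bar>(1 - r) * s\<bar> < 1"
    proof -
      have "\<bar>(1 - r) * s\<bar> \<le> 1 * \<bar>s\<bar>"
        unfolding abs_mult by (rule mult_right_mono) (use r in auto)
      then show ?thesis using s by simp
    qed
    have "(\<lambda>n. r * s / ?S * ((1 - r) * s) ^ n) sums (r * s / ?S * (1 / (1 - (1 - r) * s)))"
      by (intro sums_mult geometric_sums) (use rs in simp)
    then have "(\<lambda>n. ?b (Suc n) * s ^ Suc n) sums (r * s / ?S * (1 / (1 - (1 - r) * s)))"
      by (simp add: power_mult_distrib mult_ac)
    then have "(\<lambda>n. ?b n * s ^ n) sums (r * s / ?S * (1 / (1 - (1 - r) * s)) + (1 - 1 / ?S))"
      by (subst (asm) sums_Suc_iff) simp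
    also have "r * s / ?S * (1 / (1 - (1 - r) * s)) + (1 - 1 / ?S) =
        1 - 1 / (?S - r * ?S + r * ?S / (1 - s))"
    proof -
      have "1 - (1 - r) * s \<noteq> 0" using rs by linarith
      moreover have "?S - r * ?S + r * ?S / (1 - s) = ?S * (1 - (1 - r) * s) / (1 - s)"
        using s by (simp add: field_simps)
      moreover have "r * s / (1 - (1 - r) * s) = 1 - (1 - s) / (1 - (1 - r) * s)"
        using \<open>1 - (1 - r) * s \<noteq> 0\<close> by (simp add: field_simps)
      then have "r * s / (1 - (1 - r) * s) / ?S = (1 - (1 - s) / (1 - (1 - r) * s)) / ?S"
        by (rule arg_cong)
      then have "r * s / ?S * (1 / (1 - (1 - r) * s)) = 1 / ?S - (1 - s) / (?S * (1 - (1 - r) * s))"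
        by (simp add: diff_divide_distrib mult.commute)
      ultimately show ?thesis by simp
    qed
    also have "\<dots> = expectation (\<lambda>x. s ^ gw_process \<xi> t x)"
      by (simp only: pgf_gw[OF range s] B)
    finally show "(\<lambda>n. ?b n * s ^ n) sums expectation (\<lambda>x. s ^ gw_process \<xi> t x)" .
  qed simp
qed

text \<open>Dividing by the survival probability 1/S cancels the factor 1/S in
  \<open>prob_gw\<close> and leaves a geometric law. Under the conditioned measure,
  \<open>cond_expectation_event\<close> is an ordinary mean, so
  \<open>geometric_tail_above_mean\<close> applies.\<close>

lemma (in quenched_offspring) cond_prob_gw_tail:
  assumes range: "\<And>t. t \<ge> 1 \<Longrightarrow> p t \<in> {0<..<1} \<and> \<alpha> t \<in> {0<..<1}" and t: "t \<ge> 1" and a: "a \<ge> 0"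
  defines "r \<equiv> env_\<rho> p \<alpha> t"
  shows "\<P>(x in Q. real (gw_process \<xi> t x)
      / cond_expectation_event Q (\<lambda>y. real (gw_process \<xi> t y)) (\<lambda>y. gw_process \<xi> t y \<ge> 1) > a
      \<bar> gw_process \<xi> t x \<ge> 1) = (1 - r) ^ nat \<lfloor>a / r\<rfloor>"
proof -
  let ?S = "env_S p \<alpha> t" and ?A = "{x \<in> space Q. gw_process \<xi> t x \<ge> 1}"
  have S: "?S \<ge> 1" by (rule env_S_ge_1[OF range])
  have r: "0 < r" "r < 1" using env_\<rho>_bounds[of p \<alpha> t, OF range] t by (auto simp: r_def)
  have pA: "prob ?A = 1 / ?S"
  proof -
    have "prob ?A = 1 - prob {x \<in> space Q. gw_process \<xi> t x = 0}"
      by (subst prob_compl[symmetric]) (auto intro!: arg_cong[where f=prob])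
    then show ?thesis by (simp add: prob_gw[OF range t])
  qed
  have eA: "emeasure Q ?A \<noteq> 0" "emeasure Q ?A \<noteq> \<infinity>"
    using pA S by (auto simp: emeasure_eq_measure)
  interpret U: prob_space "uniform_measure Q ?A"
    by (rule prob_space_uniform_measure[OF eA])
  have U: "U.prob {x \<in> space Q. P x} = \<P>(x in Q. P x \<bar> gw_process \<xi> t x \<ge> 1)"
    if [measurable]: "Measurable.pred Q P" for P
    using measure_uniform_measure[OF eA, of "{x \<in> space Q. P x}"]
    by (auto simp: cond_prob_def intro!: arg_cong2[where f="(/)"] arg_cong[where f=prob])
  have "U.prob {x \<in> space (uniform_measure Q ?A). gw_process \<xi> t x = k} = r * (1 - r) ^ (k - 1)"
    if k: "k \<ge> 1" for k
  proof -
    have "prob {x \<in> space Q. gw_process \<xi> t x = k \<and> gw_process \<xi> t x \<ge> 1} = r * (1 - r) ^ (k - 1) / ?S"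
      using prob_gw[OF range t, of k] k by (auto simp: r_def conj_commute cong: conj_cong)
    then show ?thesis using S pA by (simp add: U cond_prob_def del: One_nat_def)
  qed
  from U.geometric_tail_above_mean[OF _ r a this] show ?thesis
    by (simp add: U cond_expectation_event_def del: One_nat_def)
qed

theorem theorem2p2:
  fixes M :: "'w measure" and p \<alpha> :: "nat \<Rightarrow> 'w \<Rightarrow> real"
    and Q :: "'w \<Rightarrow> 'b measure" and \<xi> :: "nat \<Rightarrow> nat \<Rightarrow> 'b \<Rightarrow> nat"
  assumes "iid_environment M p \<alpha>"
    and "\<And>w. w \<in> space M \<Longrightarrow> quenched_offspring (Q w) (\<lambda>t. p t w) (\<lambda>t. \<alpha> t w) \<xi>"
    and "AE w in M. (\<lambda>t. env_\<rho> (\<lambda>t. p t w) (\<lambda>t. \<alpha> t w) t) \<longlonglongrightarrow> 0"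
  shows "\<forall>a::real. a \<ge> 0 \<longrightarrow> (AE w in M.
    (\<lambda>t. \<P>(x in Q w.
        real (gw_process \<xi> t x)
          / cond_expectation_event (Q w) (\<lambda>y. real (gw_process \<xi> t y)) (\<lambda>y. gw_process \<xi> t y \<ge> 1) > a
        \<bar> gw_process \<xi> t x \<ge> 1)) \<longlonglongrightarrow> exp (- a))"
proof (intro allI impI)
  fix a :: real assume a: "a \<ge> 0"
  show "AE w in M. (\<lambda>t. \<P>(x in Q w.
        real (gw_process \<xi> t x)
          / cond_expectation_event (Q w) (\<lambda>y. real (gw_process \<xi> t y)) (\<lambda>y. gw_process \<xi> t y \<ge> 1) > a
        \<bar> gw_process \<xi> t x \<ge> 1)) \<longlonglongrightarrow> exp (- a)"
    \<comment> \<open>The exceptional null set comes from the convergence of rho; the rest of the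
      argument works for every such w in \<open>space M\<close>.\<close>
    using assms(3) AE_space
  proof eventually_elim
    case (elim w)
    interpret quenched_offspring "Q w" "\<lambda>t. p t w" "\<lambda>t. \<alpha> t w" \<xi>
      by (rule assms(2)[OF elim(2)])
    let ?r = "env_\<rho> (\<lambda>t. p t w) (\<lambda>t. \<alpha> t w)"
    have range: "p t w \<in> {0<..<1} \<and> \<alpha> t w \<in> {0<..<1}" if "t \<ge> 1" for t
      using iid_environment.env_range[OF assms(1) that elim(2)] .
    \<comment> \<open>Positivity of rho upgrades convergence to 0 to convergence from the right, the
      mode used in the exponential limit.\<close>
    have "filterlim ?r (at_right 0) sequentially"
      using elim(1) env_\<rho>_bounds(1)[of "\<lambda>t. p t w" "\<lambda>t. \<alpha> t w", OF range]
      by (intro tendsto_imp_filterlim_at_right always_eventually allI)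
    then have "(\<lambda>t. (1 - ?r t) ^ nat \<lfloor>a / ?r t\<rfloor>) \<longlonglongrightarrow> exp (- a)"
      by (rule filterlim_compose[OF tendsto_one_minus_power_floor[OF a]])
    \<comment> \<open>The closed form is applied from t = 1 on, which is enough for the
      limit.\<close>
    then show ?case
      by (rule Lim_transform_eventually)
         (use cond_prob_gw_tail[OF range _ a] in \<open>auto intro!: eventually_sequentiallyI[of 1]\<close>)
  qed
qed

end
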